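(* Let $A$ and $K$ be the transformations of pairs of rational numbers given by $A:(r,s)\mapsto(s-r,s)$ and $K:(r,s)\mapsto(1-r,\tfrac12-r+s)$. The group $G$ generated by $A$ and $K$ (under composition) is isomorphic to $D_6$, the dihedral group of order 12.
   Context: $D_n$ denotes the dihedral group of order $2n$. *)

theory Defs
  imports Complex_Main "HOL-Algebra.Elementary_Groups" "HOL-Algebra.Bij"
begin

definition A :: "rat \<times> rat \<Rightarrow> rat \<times> rat" where
  "A = (\<lambda>(r, s). (s - r, s))"

definition K :: "rat \<times> rat \<Rightarrow> rat \<times> rat" where
  "K = (\<lambda>(r, s). (1 - r, 1 / 2 - r + s))"

lemma A_in_BijGroup: "A \<in> carrier (BijGroup UNIV)"
proof -
  have "bij A"
    by (rule involuntory_imp_bij) (auto simp: A_def)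
  then show ?thesis by (simp add: BijGroup_def Bij_def extensional_def)
qed

lemma K_in_BijGroup: "K \<in> carrier (BijGroup UNIV)"
proof -
  have "bij K"
    by (rule involuntory_imp_bij) (auto simp: K_def)
  then show ?thesis by (simp add: BijGroup_def Bij_def extensional_def)
qed

(* BijGroup UNIV is the group of all permutations of the type, with composition as
   multiplication. subgroup_generated only uses the generators lying in the carrier;
   by the two lemmas above neither A nor K is lost. *)
definition G :: "(rat \<times> rat \<Rightarrow> rat \<times> rat) monoid" where
  "G = subgroup_generated (BijGroup UNIV) {A, K}"

(* The dihedral group of order 2n (for n > 0), as the semidirect product of Z/n by Z/2
   acting by inversion: (a, e) stands for the rotation \<rho>^a if e is False, and for the
   reflection \<rho>^a \<sigma> if e is True, where \<sigma> \<rho> \<sigma> = \<rho>^(-1). *)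
definition dihedral_group :: "nat \<Rightarrow> (int \<times> bool) monoid" where
  "dihedral_group n =
    \<lparr>carrier = {0..<int n} \<times> UNIV,
     mult = (\<lambda>(a, e) (b, f). ((if e then a - b else a + b) mod int n, e \<noteq> f)),
     one = (0, False)\<rparr>"

lemma group_dihedral_group:
  assumes "n > 0"
  shows "group (dihedral_group n)"
proof (rule groupI)
  fix x y z
  assume "x \<in> carrier (dihedral_group n)" "y \<in> carrier (dihedral_group n)"
    "z \<in> carrier (dihedral_group n)"
  show "x \<otimes>\<^bsub>dihedral_group n\<^esub> y \<otimes>\<^bsub>dihedral_group n\<^esub> z
      = x \<otimes>\<^bsub>dihedral_group n\<^esub> (y \<otimes>\<^bsub>dihedral_group n\<^esub> z)"
    by (cases x; cases y; cases z) (auto simp: dihedral_group_def mod_simps algebra_simps)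
next
  fix x
  assume x: "x \<in> carrier (dihedral_group n)"
  obtain a e where [simp]: "x = (a, e)" by (cases x)
  show "\<exists>y\<in>carrier (dihedral_group n). y \<otimes>\<^bsub>dihedral_group n\<^esub> x = \<one>\<^bsub>dihedral_group n\<^esub>"
    by (rule bexI[of _ "if e then x else ((- a) mod int n, False)"])
      (use x assms in \<open>auto simp: dihedral_group_def mod_simps\<close>)
qed (use assms in \<open>auto simp: dihedral_group_def\<close>)

lemma order_dihedral_group: "order (dihedral_group n) = 2 * n"
  by (simp add: order_def dihedral_group_def card_cartesian_product)

end

theory Submission
  imports Defs "HOL-Algebra.Multiplicative_Group"
begin

text \<open>
  Two involutions \<open>x\<close> and \<open>y\<close> of any group always generate a dihedral group: conjugation by \<open>y\<close>
  turns \<open>\<rho> = x \<otimes> y\<close> into \<open>y \<otimes> x = inv \<rho>\<close>, so every element generated by them has the form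
  \<open>\<rho>\<^sup>a\<close> or \<open>\<rho>\<^sup>a \<otimes> y\<close>, and these multiply like rotations and reflections. If \<open>\<rho>\<close> has finite order
  \<open>n > 2\<close>, there is no further collapse, and the group is dihedral of order \<open>2 n\<close>
  (\<open>subgroup_generated_by_involutions_dihedral\<close>).

  The maps \<open>A\<close> and \<open>K\<close> are involutions, so only the order of \<open>A \<circ> K\<close> has to be found. This affine
  map has the linear part \<open>(r, s) \<mapsto> (s, s - r)\<close>, with characteristic polynomial \<open>X\<^sup>2 - X + 1\<close>,
  whose roots are the primitive sixth roots of unity; since 1 is not a root, \<open>A \<circ> K\<close> has a fixed
  point, namely \<open>(1/2, 1)\<close>, and is conjugate by a translation to its linear part. Its order is
  therefore 6 (\<open>ord_A_K\<close>).
\<close>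

context group
begin

text \<open>
  Conjugation by the involution \<open>y\<close> is an endomorphism \<open>z \<mapsto> y \<otimes> z \<otimes> y\<close> that sends \<open>x \<otimes> y\<close> to
  \<open>y \<otimes> x\<close>, its inverse; as an endomorphism it commutes with taking powers.
\<close>
lemma involution_conjugates_int_pow:
  assumes x: "x \<in> carrier G" "x \<otimes> x = \<one>" and y: "y \<in> carrier G" "y \<otimes> y = \<one>"
  shows "y \<otimes> (x \<otimes> y) [^] (k::int) = (x \<otimes> y) [^] (- k) \<otimes> y"
proof -
  have "(\<lambda>z. y \<otimes> z \<otimes> y) \<in> hom G G"
  proof (rule homI)
    fix u v assume uv: "u \<in> carrier G" "v \<in> carrier G"
    have "y \<otimes> u \<otimes> y \<otimes> (y \<otimes> v \<otimes> y) = y \<otimes> u \<otimes> (y \<otimes> y) \<otimes> (v \<otimes> y)"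
      using uv y(1) by (simp add: m_assoc)
    with uv y show "y \<otimes> (u \<otimes> v) \<otimes> y = y \<otimes> u \<otimes> y \<otimes> (y \<otimes> v \<otimes> y)"
      by (simp add: m_assoc)
  qed (use y in auto)
  then interpret conj: group_hom G G "\<lambda>z. y \<otimes> z \<otimes> y"
    by unfold_locales
  have "y \<otimes> (x \<otimes> y) \<otimes> y = inv (x \<otimes> y)"
    using x y by (simp add: m_assoc inv_mult_group inv_equality)
  then have conj_pow: "y \<otimes> (x \<otimes> y) [^] k \<otimes> y = (x \<otimes> y) [^] (- k)"
    using conj.hom_int_pow[of "x \<otimes> y" k] x y by (simp add: int_pow_inv int_pow_neg)
  have "y \<otimes> (x \<otimes> y) [^] k = y \<otimes> (x \<otimes> y) [^] k \<otimes> y \<otimes> y"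
    using x y by (simp add: m_assoc)
  then show ?thesis by (simp only: conj_pow)
qed

text \<open>
  A power of \<open>x \<otimes> y\<close> commutes with \<open>x \<otimes> y\<close>, whereas \<open>y\<close> inverts it. If \<open>y\<close> does both, then
  \<open>x \<otimes> y\<close> is its own inverse, which the bound on the order excludes. This is what keeps
  rotations and reflections apart.
\<close>
lemma involution_not_rotation:
  assumes x: "x \<in> carrier G" "x \<otimes> x = \<one>" and y: "y \<in> carrier G" "y \<otimes> y = \<one>"
    and "ord (x \<otimes> y) > 2"
  shows "y \<noteq> (x \<otimes> y) [^] (k::int)"
proof
  assume y_eq: "y = (x \<otimes> y) [^] k"
  have xy: "x \<otimes> y \<in> carrier G" using x y by simp
  have "y \<otimes> (x \<otimes> y) = (x \<otimes> y) \<otimes> y"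
    using int_pow_mult[OF xy, of k 1] int_pow_mult[OF xy, of 1 k] xy
    by (simp add: add.commute flip: y_eq)
  also have "\<dots> = x"
    using x y by (simp add: m_assoc)
  finally have "y \<otimes> (x \<otimes> y) = x" .
  then have "(x \<otimes> y) [^] (2::nat) = \<one>"
    using x y by (simp add: numeral_2_eq_2 m_assoc)
  then have "ord (x \<otimes> y) dvd 2"
    using pow_eq_id[OF xy] by simp
  with assms(5) show False
    by (auto dest: dvd_imp_le)
qed

text \<open>
  The isomorphism is \<open>(a, e) \<mapsto> \<rho>\<^sup>a \<otimes> y\<^sup>e\<close>. Its image is a subgroup that contains \<open>y\<close> and \<open>x = \<rho> \<otimes> y\<close>,
  hence is all that they generate; its kernel is trivial because no reflection is a rotation and
  \<open>\<rho>\<close> has order exactly \<open>n\<close>.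
\<close>
theorem subgroup_generated_by_involutions_dihedral:
  assumes x: "x \<in> carrier G" "x \<otimes> x = \<one>" and y: "y \<in> carrier G" "y \<otimes> y = \<one>"
    and ord: "ord (x \<otimes> y) = n" and n: "n > 2"
  shows "subgroup_generated G {x, y} \<cong> dihedral_group n"
proof -
  define \<rho> where "\<rho> = x \<otimes> y"
  have \<rho>: "\<rho> \<in> carrier G" using x y by (simp add: \<rho>_def)
  have ord_\<rho>: "ord \<rho> = n" using ord by (simp add: \<rho>_def)
  have swap: "y \<otimes> \<rho> [^] k = \<rho> [^] (- k) \<otimes> y" for k :: int
    unfolding \<rho>_def by (rule involution_conjugates_int_pow[OF x y])
  have y_not_pow: "y \<noteq> \<rho> [^] k" for k :: int
    unfolding \<rho>_def using involution_not_rotation[OF x y] ord n by simp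
  have pow_mod: "\<rho> [^] (k mod int n) = \<rho> [^] k" for k :: int
    using \<rho> ord_\<rho> by (simp add: int_pow_eq minus_mod_eq_mult_div)
  define \<phi> where "\<phi> = (\<lambda>(a::int, e). \<rho> [^] a \<otimes> (if e then y else \<one>))"
  let ?D = "dihedral_group n" and ?H = "subgroup_generated G {x, y}"
  have \<phi>_closed: "\<phi> p \<in> carrier G" for p
    using \<rho> y by (auto simp: \<phi>_def split: prod.split)
  have \<phi>_hom: "\<phi> \<in> hom ?D G"
  proof (rule homI)
    fix p q :: "int \<times> bool"
    obtain a e b f where [simp]: "p = (a, e)" "q = (b, f)" by (cases p; cases q)
    have "\<phi> p \<otimes> \<phi> q = \<rho> [^] a \<otimes> ((if e then y else \<one>) \<otimes> \<rho> [^] b) \<otimes> (if f then y else \<one>)"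
      using \<rho> y by (simp add: \<phi>_def m_assoc)
    also have "\<dots> = \<rho> [^] a \<otimes> (\<rho> [^] (if e then - b else b) \<otimes> (if e then y else \<one>))
        \<otimes> (if f then y else \<one>)"
      using \<rho> by (simp add: swap)
    also have "\<dots> = \<rho> [^] (if e then a - b else a + b) \<otimes> (if e \<noteq> f then y else \<one>)"
      using \<rho> y by (simp add: m_assoc int_pow_mult int_pow_diff int_pow_neg)
    also have "\<dots> = \<phi> (p \<otimes>\<^bsub>?D\<^esub> q)"
      using pow_mod by (simp add: \<phi>_def dihedral_group_def)
    finally show "\<phi> (p \<otimes>\<^bsub>?D\<^esub> q) = \<phi> p \<otimes> \<phi> q" by simp
  qed (rule \<phi>_closed)
  interpret D: group ?D
    using n by (simp add: group_dihedral_group)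
  interpret \<phi>: group_hom ?D G \<phi>
    by unfold_locales (rule \<phi>_hom)
  have x_in: "x \<in> carrier ?H" and y_in: "y \<in> carrier ?H"
    using x y by (auto simp: carrier_subgroup_generated intro: generate.incl)
  have H: "subgroup (carrier ?H) G"
    by (rule subgroup_subgroup_generated)
  have image: "\<phi> ` carrier ?D = carrier ?H"
  proof
    have "\<phi> p \<in> carrier ?H" for p
      using x_in y_in H \<rho>_def
      by (auto simp: \<phi>_def subgroup.m_closed subgroup.one_closed subgroup_int_pow_closed
          split: prod.split)
    then show "\<phi> ` carrier ?D \<subseteq> carrier ?H" by auto
    have "\<phi> (0, True) = y" "\<phi> (1, True) = x"
      using x y by (simp_all add: \<phi>_def \<rho>_def m_assoc int_pow_1)
    moreover have "(0, True) \<in> carrier ?D" "(1, True) \<in> carrier ?D"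
      using n by (simp_all add: dihedral_group_def)
    ultimately have "{x, y} \<subseteq> \<phi> ` carrier ?D"
      by (metis empty_subsetI imageI insert_subset)
    then show "carrier ?H \<subseteq> \<phi> ` carrier ?D"
      by (rule subgroup_generated_minimal[OF \<phi>.img_is_subgroup])
  qed
  have inj: "inj_on \<phi> (carrier ?D)"
  proof (subst \<phi>.inj_on_one_iff, intro allI impI)
    fix p assume p: "p \<in> carrier ?D" and one: "\<phi> p = \<one>"
    obtain a e where [simp]: "p = (a, e)" by (cases p)
    have "\<not> e"
    proof
      assume e
      with one have "\<rho> [^] a \<otimes> y \<otimes> y = y"
        using y by (simp add: \<phi>_def)
      then have "y = \<rho> [^] a"
        using \<rho> y by (simp add: m_assoc)
      with y_not_pow show False by blast
    qed
    with one have "int n dvd a"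
      using \<rho> ord_\<rho> by (simp add: \<phi>_def int_pow_eq_id)
    with p have "a = 0"
      by (auto simp: dihedral_group_def dvd_eq_mod_eq_0)
    with \<open>\<not> e\<close> show "p = \<one>\<^bsub>?D\<^esub>"
      by (simp add: dihedral_group_def)
  qed
  have "\<phi> \<in> hom ?D ?H"
    using \<phi>_hom image by (auto simp: hom_def)
  with image inj have "\<phi> \<in> iso ?D ?H"
    by (simp add: iso_def bij_betw_def)
  then show ?thesis
    by (meson D.iso_sym is_isoI)
qed

end

lemma mult_BijGroup_UNIV:
  assumes "f \<in> carrier (BijGroup UNIV)" "g \<in> carrier (BijGroup UNIV)"
  shows "f \<otimes>\<^bsub>BijGroup UNIV\<^esub> g = f \<circ> g"
  using assms by (auto simp: BijGroup_def compose_def)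

lemma one_BijGroup_UNIV: "\<one>\<^bsub>BijGroup UNIV\<^esub> = id"
  by (auto simp: BijGroup_def)

lemma nat_pow_BijGroup_UNIV:
  assumes f: "f \<in> carrier (BijGroup UNIV)"
  shows "f [^]\<^bsub>BijGroup UNIV\<^esub> (n::nat) = f ^^ n"
proof (induction n)
  case 0
  show ?case by (simp add: one_BijGroup_UNIV)
next
  case (Suc n)
  interpret group "BijGroup UNIV" by (rule group_BijGroup)
  have "f ^^ n \<in> carrier (BijGroup UNIV)"
    using f Suc by (metis nat_pow_closed)
  with Suc f show ?case
    by (simp add: mult_BijGroup_UNIV funpow_Suc_right del: funpow.simps)
qed

lemma A_comp_K: "A \<circ> K = (\<lambda>(r, s). (s - 1 / 2, 1 / 2 - r + s))"
  by (auto simp: A_def K_def)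

lemma A_comp_K_pow2: "(A \<circ> K) ^^ 2 = (\<lambda>(r, s). (s - r, 3 / 2 - r))"
  unfolding A_comp_K by (auto simp: numeral_2_eq_2)

text \<open>The cube of \<open>A \<circ> K\<close> is the point reflection in its fixed point \<open>(1/2, 1)\<close>.\<close>
lemma A_comp_K_pow3: "(A \<circ> K) ^^ 3 = (\<lambda>(r, s). (1 - r, 2 - s))"
  unfolding A_comp_K by (auto simp: numeral_3_eq_3)

lemma A_comp_K_pow6: "(A \<circ> K) ^^ 6 = id"
proof -
  have "(A \<circ> K) ^^ 6 = (A \<circ> K) ^^ 3 \<circ> (A \<circ> K) ^^ 3"
    by (simp flip: funpow_add)
  then show ?thesis by (auto simp: A_comp_K_pow3)
qed

text \<open>
  The sixth power is the identity, but neither the square nor the cube is, and a divisor of 6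
  that divides neither 2 nor 3 is 6 itself.
\<close>
lemma ord_A_K: "group.ord (BijGroup UNIV) (A \<otimes>\<^bsub>BijGroup UNIV\<^esub> K) = 6"
proof -
  interpret group "BijGroup (UNIV :: (rat \<times> rat) set)" by (rule group_BijGroup)
  let ?R = "A \<otimes>\<^bsub>BijGroup UNIV\<^esub> K"
  have R: "?R = A \<circ> K" "?R \<in> carrier (BijGroup UNIV)"
    using A_in_BijGroup K_in_BijGroup by (simp_all add: mult_BijGroup_UNIV[symmetric])
  have ord_dvd: "ord ?R dvd m \<longleftrightarrow> (A \<circ> K) ^^ m = id" for m
    using pow_eq_id[OF R(2), of m] nat_pow_BijGroup_UNIV[OF R(2)] R(1)
    by (simp add: one_BijGroup_UNIV)
  have dvd6: "ord ?R dvd 6"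
    by (simp add: ord_dvd A_comp_K_pow6)
  have not2: "\<not> ord ?R dvd 2" and not3: "\<not> ord ?R dvd 3"
    by (auto simp: ord_dvd A_comp_K_pow2 A_comp_K_pow3 fun_eq_iff intro!: exI[of _ 0])
  have "ord ?R \<in> {..6}"
    using dvd6 by (auto dest: dvd_imp_le)
  then have "ord ?R \<in> {0, 1, 2, 3, 4, 5, 6}"
    by auto
  with dvd6 not2 not3 show ?thesis by (elim insertE) auto
qed

theorem proposition2p4:
  shows "G \<cong> dihedral_group 6"
proof -
  interpret group "BijGroup (UNIV :: (rat \<times> rat) set)" by (rule group_BijGroup)
  have "A \<otimes>\<^bsub>BijGroup UNIV\<^esub> A = \<one>\<^bsub>BijGroup UNIV\<^esub>"
    using A_in_BijGroup by (auto simp: mult_BijGroup_UNIV one_BijGroup_UNIV A_def)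
  moreover have "K \<otimes>\<^bsub>BijGroup UNIV\<^esub> K = \<one>\<^bsub>BijGroup UNIV\<^esub>"
    using K_in_BijGroup by (auto simp: mult_BijGroup_UNIV one_BijGroup_UNIV K_def)
  ultimately show ?thesis
    unfolding G_def using A_in_BijGroup K_in_BijGroup ord_A_K
    by (intro subgroup_generated_by_involutions_dihedral) auto
qed

end
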